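(* Let $A, B \in \mathbb{R}^{n\times n}$. If $A$ is nonsingular and $\sigma_{1}(A^{-1}B) < 1$, then for every $b \in \mathbb{R}^n$ the generalized absolute value equation $Ax + B|x| = b$ has a unique solution $x \in \mathbb{R}^n$.
   Context: For $x \in \mathbb{R}^n$, $|x|$ denotes the componentwise absolute value of $x$. $\sigma_1(\cdot)$ denotes the maximal singular value of a matrix. *)

theory Defs
  imports "HOL-Analysis.Analysis"
begin

text \<open>
  The Gram matrix \<open>transpose M ** M\<close> is symmetric positive semidefinite, so all its eigenvalues are
  real and nonnegative; ranging over real \<open>l\<close> and real eigenvectors below therefore loses nothing.
\<close>

definition eigenvalue :: "real^'n^'n \<Rightarrow> real \<Rightarrow> bool" where
  "eigenvalue M l \<longleftrightarrow> (\<exists>v. v \<noteq> 0 \<and> M *v v = l *\<^sub>R v)"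

definition singular_values :: "real^'n^'n \<Rightarrow> real set" where
  "singular_values M = {sqrt l | l. eigenvalue (transpose M ** M) l}"

text \<open>
  The set of singular values is finite and nonempty (the index type \<open>'n\<close> is nonempty, and a real
  symmetric matrix has a real eigenvalue), so \<open>Max\<close> is the genuine maximum.
\<close>

definition sigma_max :: "real^'n^'n \<Rightarrow> real" where
  "sigma_max M = Max (singular_values M)"

end

theory Submission
  imports Defs
begin

text \<open>
  The matrix \<open>M = A\<^sup>-\<^sup>1 B\<close> contracts Euclidean distances by the factor \<open>\<sigma>\<^sub>1(M) < 1\<close>, and the componentwise
  absolute value does not increase them. The equation says that \<open>x\<close> is a fixed point of the
  contraction \<open>x \<mapsto> A\<^sup>-\<^sup>1 b - M \<bar>x\<bar>\<close>, so Banach's theorem applies. That \<open>\<sigma>\<^sub>1\<close> bounds the operator norm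
  holds because \<open>\<parallel>M x\<parallel>\<close> attains its maximum over the unit sphere at an eigenvector of \<open>M\<^sup>T M\<close>.
\<close>

text \<open>Since the right-hand side is symmetric in \<open>x\<close> and \<open>y\<close>, this
  also makes the Gram matrix self-adjoint.\<close>

lemma inner_gram:
  fixes M :: "real^'n^'n"
  shows "((transpose M ** M) *v x) \<bullet> y = (M *v x) \<bullet> (M *v y)"
  by (metis dot_lmul_matrix matrix_vector_mul_assoc transpose_matrix_vector)

text \<open>Eigenvectors of a self-adjoint map for distinct eigenvalues are orthogonal, hence
  independent, and there are only finitely many of those. Finiteness is what makes
  \<open>Max\<close> an upper bound for the singular values.\<close>

lemma finite_eigenvalues_gram:
  fixes M :: "real^'n^'n"
  shows "finite {l. eigenvalue (transpose M ** M) l}" (is "finite ?E")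
proof -
  let ?G = "transpose M ** M"
  have "\<forall>l\<in>?E. \<exists>v. v \<noteq> 0 \<and> ?G *v v = l *\<^sub>R v"
    by (simp add: eigenvalue_def)
  then obtain v where v: "\<And>l. l \<in> ?E \<Longrightarrow> v l \<noteq> 0" "\<And>l. l \<in> ?E \<Longrightarrow> ?G *v v l = l *\<^sub>R v l"
    by metis
  \<comment> \<open>A nonzero vector determines its eigenvalue, so finiteness of the image pulls
    back to \<open>?E\<close>.\<close>
  have inj: "inj_on v ?E"
    by (rule inj_onI) (metis v scaleR_cancel_right)
  have orth: "v k \<bullet> v l = 0" if "k \<in> ?E" "l \<in> ?E" "k \<noteq> l" for k l
  proof -
    have "(?G *v v k) \<bullet> v l = (?G *v v l) \<bullet> v k"
      unfolding inner_gram by (rule inner_commute)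
    then have "k * (v k \<bullet> v l) = l * (v k \<bullet> v l)"
      using v(2)[OF that(1)] v(2)[OF that(2)] by (simp add: inner_commute)
    with \<open>k \<noteq> l\<close> show ?thesis by simp
  qed
  have "pairwise orthogonal (v ` ?E)"
    unfolding pairwise_def orthogonal_def using orth by blast
  moreover have "0 \<notin> v ` ?E"
    using v(1) by auto
  ultimately have "independent (v ` ?E)"
    by (rule pairwise_orthogonal_independent)
  then have "finite (v ` ?E)"
    by (rule independent_imp_finite)
  with inj show ?thesis
    by (rule finite_imageD[rotated])
qed

text \<open>First-order optimality without derivatives: \<open>f\<close> is a nonnegative quadratic
  form that vanishes at \<open>v\<close>, so \<open>v\<close> minimizes it, and its gradient there,
  \<open>2 w\<close>, must be zero.\<close>

lemma eigenvalue_gram_if_maximal: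
  fixes M :: "real^'n^'n"
  assumes v: "norm v = 1" and max: "\<And>x. norm (M *v x) \<le> norm (M *v v) * norm x"
  shows "eigenvalue (transpose M ** M) ((norm (M *v v))\<^sup>2)"
proof -
  define L where "L = (norm (M *v v))\<^sup>2"
  define w where "w = L *\<^sub>R v - (transpose M ** M) *v v"
  define f where "f x = L * (x \<bullet> x) - (M *v x) \<bullet> (M *v x)" for x
  have f_nonneg: "f x \<ge> 0" for x
    using power_mono[OF max[of x], of 2]
    by (simp add: f_def L_def power_mult_distrib flip: power2_norm_eq_inner)
  have fv: "f v = 0"
    using v by (simp add: f_def L_def flip: power2_norm_eq_inner)
  \<comment> \<open>Unfolding only the left \<open>w\<close> exhibits the cross term in the
    expansion of \<open>f\<close> at \<open>v\<close> along \<open>w\<close>.\<close>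
  have ww: "w \<bullet> w = L * (v \<bullet> w) - (M *v v) \<bullet> (M *v w)"
    by (subst (1) w_def) (simp add: inner_diff_left inner_gram)
  have "f (v - e *\<^sub>R w) = f v - 2 * e * (w \<bullet> w) + e\<^sup>2 * f w" for e
    unfolding ww
    by (simp add: f_def matrix_vector_mult_diff_distrib matrix_vector_mult_scaleR
        inner_diff_left inner_diff_right inner_commute power2_eq_square algebra_simps)
  then have quad: "2 * e * (w \<bullet> w) \<le> e\<^sup>2 * f w" for e
    using f_nonneg[of "v - e *\<^sub>R w"] fv by simp
  have "w \<bullet> w \<le> 0"
  proof (cases "f w = 0")
    case True
    then show ?thesis using quad[of 1] by simp
  next
    case False
    then have "f w > 0" using f_nonneg[of w] by simp
    \<comment> \<open>This step length minimizes \<open>e^2 * f w - 2 * e * (w \<bullet> w)\<close>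
      over \<open>e\<close>.\<close>
    then have "(w \<bullet> w)\<^sup>2 \<le> 0"
      using quad[of "(w \<bullet> w) / f w"] by (simp add: field_simps power2_eq_square)
    then show ?thesis by simp
  qed
  then have "w = 0" using inner_gt_zero_iff[of w] by linarith
  then have "(transpose M ** M) *v v = L *\<^sub>R v"
    by (simp add: w_def)
  moreover have "v \<noteq> 0" using v by auto
  ultimately show ?thesis
    unfolding eigenvalue_def L_def by blast
qed

lemma norm_matrix_vector_le_sigma_max:
  fixes M :: "real^'n^'n"
  shows "norm (M *v x) \<le> sigma_max M * norm x"
proof -
  have "continuous_on (sphere 0 1) (\<lambda>x. norm (M *v x))"
    by (intro continuous_intros matrix_vector_mult_linear_continuous_on)
  moreover have "sphere (0::real^'n) 1 \<noteq> {}"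
    by simp
  ultimately obtain v where v: "norm v = 1"
    and max: "\<And>y. norm y = 1 \<Longrightarrow> norm (M *v y) \<le> norm (M *v v)"
    using continuous_attains_sup[OF compact_sphere, of 0 1 "\<lambda>x. norm (M *v x)"] by auto
  have le: "norm (M *v x) \<le> norm (M *v v) * norm x" for x
  proof (cases "x = 0")
    case False
    then show ?thesis
      using max[of "x /\<^sub>R norm x"] by (simp add: matrix_vector_mult_scaleR field_simps)
  qed simp
  have "norm (M *v v) \<in> singular_values M"
    unfolding singular_values_def
    using eigenvalue_gram_if_maximal[OF v le] by force
  moreover have "finite (singular_values M)"
    using finite_eigenvalues_gram[of M] by (simp add: singular_values_def)
  ultimately have "norm (M *v v) \<le> sigma_max M"
    unfolding sigma_max_def by simp
  then show ?thesis
    using le[of x] mult_right_mono[of "norm (M *v v)" "sigma_max M" "norm x"] by simp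
qed

text \<open>The reverse triangle inequality holds in each coordinate.\<close>

lemma norm_abs_diff_abs_le:
  fixes x y :: "real^'n"
  shows "norm (\<bar>x\<bar> - \<bar>y\<bar>) \<le> norm (x - y)"
  by (rule norm_le_componentwise_cart) (simp add: abs_vec_def abs_triangle_ineq3)

theorem corollary3p4:
  fixes A B :: "real^'n^'n"
  assumes "invertible A"
    and "sigma_max (matrix_inv A ** B) < 1"
  shows "\<forall>b :: real^'n. \<exists>!x :: real^'n. A *v x + B *v \<bar>x\<bar> = b"
proof
  fix b :: "real^'n"
  define M where "M = matrix_inv A ** B"
  define g where "g x = matrix_inv A *v b - M *v \<bar>x\<bar>" for x
  have inv: "A ** matrix_inv A = mat 1" "matrix_inv A ** A = mat 1"
    using someI_ex[OF \<open>invertible A\<close>[unfolded invertible_def]] by (simp_all add: matrix_inv_def)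
  have fixpoint_iff: "A *v x + B *v \<bar>x\<bar> = b \<longleftrightarrow> g x = x" for x
  proof
    assume "A *v x + B *v \<bar>x\<bar> = b"
    then have "matrix_inv A *v (A *v x + B *v \<bar>x\<bar>) = matrix_inv A *v b" by simp
    then show "g x = x"
      by (simp add: g_def M_def matrix_vector_right_distrib matrix_vector_mul_assoc inv algebra_simps)
  next
    assume "g x = x"
    then have "A *v x = A *v (matrix_inv A *v b - M *v \<bar>x\<bar>)"
      by (simp add: g_def)
    then show "A *v x + B *v \<bar>x\<bar> = b"
      by (simp add: M_def matrix_vector_mult_diff_distrib matrix_vector_mul_assoc matrix_mul_assoc inv)
  qed
  \<comment> \<open>Testing the norm bound on a unit vector gives the sign.\<close>
  have sigma_nonneg: "0 \<le> sigma_max M"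
    using norm_matrix_vector_le_sigma_max[of M "axis undefined 1"] norm_ge_zero
    by (metis mult.right_neutral norm_axis_1 order_trans)
  have "dist (g x) (g y) \<le> sigma_max M * dist x y" for x y
  proof -
    have "dist (g x) (g y) = norm (M *v (\<bar>x\<bar> - \<bar>y\<bar>))"
      by (simp add: g_def dist_norm matrix_vector_mult_diff_distrib norm_minus_commute)
    also have "\<dots> \<le> sigma_max M * norm (\<bar>x\<bar> - \<bar>y\<bar>)"
      by (rule norm_matrix_vector_le_sigma_max)
    also have "\<dots> \<le> sigma_max M * dist x y"
      unfolding dist_norm by (intro mult_left_mono norm_abs_diff_abs_le sigma_nonneg)
    finally show ?thesis .
  qed
  then have "\<exists>!x. g x = x"
    using banach_fix_type[of "sigma_max M" g] sigma_nonneg assms(2) by (simp add: M_def)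
  then show "\<exists>!x. A *v x + B *v \<bar>x\<bar> = b"
    by (simp add: fixpoint_iff)
qed

end
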